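(* Let $\chi$ be a primitive Dirichlet character, let $S$ be a finite set of primes, and let $f:\mathbb{N}\to\mathbb{C}$ be a completely multiplicative function such that $f(p)=\chi(p)$ for every prime $p\notin S$, while for every $p\in S$ we have $f(p)\neq\chi(p)$ and $|f(p)|=1$. Then $$\sum_{n\leq x}f(n)=\Omega\big((\log x)^{(|S|-3)/2}\big),$$ that is, $\limsup_{x\to\infty}\Big|\sum_{n\le x}f(n)\Big|\big/(\log x)^{(|S|-3)/2}>0$.
   Context: A modified Dirichlet character is a completely multiplicative function $f$ for which there are a Dirichlet character $\chi$ and a finite set of primes $S$ (the modification set) such that $f(p)=\chi(p)$ for all primes $p\notin S$, and $f(p)\neq \chi(p)$, $|f(p)|\le 1$ for $p\in S$. $|S|$ denotes the cardinality of $S$. For $N(x)>0$, $M(x)=\Omega(N(x))$ means $\limsup_{x\to\infty}|M(x)|/N(x)>0$. *)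

theory Defs
  imports "HOL-Analysis.Analysis" "HOL-Computational_Algebra.Primes"
begin

definition completely_multiplicative :: "(nat \<Rightarrow> complex) \<Rightarrow> bool" where
  "completely_multiplicative f \<longleftrightarrow> f 1 = 1 \<and> (\<forall>m n. f (m * n) = f m * f n)"

definition dirichlet_character :: "nat \<Rightarrow> (nat \<Rightarrow> complex) \<Rightarrow> bool" where
  "dirichlet_character q chi \<longleftrightarrow> q \<ge> 1 \<and> completely_multiplicative chi
     \<and> (\<forall>n. chi (n + q) = chi n)
     \<and> (\<forall>n. chi n = 0 \<longleftrightarrow> \<not> coprime n q)"

definition induced_modulus :: "nat \<Rightarrow> (nat \<Rightarrow> complex) \<Rightarrow> nat \<Rightarrow> bool" where
  "induced_modulus q chi d \<longleftrightarrow> d dvd q \<and>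
     (\<forall>m n. coprime m q \<longrightarrow> coprime n q \<longrightarrow> m mod d = n mod d \<longrightarrow> chi m = chi n)"

definition primitive_character :: "nat \<Rightarrow> (nat \<Rightarrow> complex) \<Rightarrow> bool" where
  "primitive_character q chi \<longleftrightarrow> dirichlet_character q chi \<and>
     (\<forall>d. induced_modulus q chi d \<longrightarrow> d = q)"

end

theory Submission
  imports Defs "HOL-Number_Theory.Residues"
begin

text \<open>
  Truncate \<open>f\<close> by setting it to \<open>0\<close> at multiples of \<open>p\<^sup>N\<close>, \<open>p \<in> S\<close>. By inclusion-exclusion the partial
  sums \<open>H\<close> of the truncation are at most \<open>2\<^bsup>|S|\<^esup>\<close> times as large as those of \<open>f\<close>. On the other hand the
  truncation is periodic modulo \<open>P = q \<Prod>p\<^sup>N\<close>, since it is the convolution of \<open>chi\<close> with a function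
  supported on the divisors of \<open>\<Prod>p\<^sup>N\<close>; so \<open>H\<close> is periodic as well, unless it grows linearly.
  For \<open>D = \<Prod>p\<^bsup>i(p)\<^esup>\<close> the Fourier coefficient of the truncation at the frequency \<open>1 / (q D)\<close> is an Euler
  product times the Gauss sum of \<open>chi\<close>, of size at least a constant times \<open>1 / D\<close>, and partial
  summation divides it by \<open>|1 - e(1 / (q D))| \<le> 2 pi / (q D)\<close>. Hence about \<open>N\<^bsup>|S|\<^esup>\<close> Fourier coefficients of
  \<open>H\<close> are bounded below, and Bessel's inequality gives \<open>|H|\<^sup>2 \<ge> c N\<^bsup>|S|\<^esup> \<ge> c' (log P)\<^bsup>|S|\<^esup>\<close> somewhere in a period.
\<close>

subsection \<open>Finite Fourier analysis\<close>

text \<open>Bessel's inequality with characters of squared norm \<open>P\<close>: if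
  \<open>y\<close> is the synthesis of the coefficients \<open>a\<close>, orthogonality turns the
  nonnegative sum of the squared norms of \<open>P * g - y\<close> into \<open>P^2\<close> times the
  energy of \<open>g\<close> minus \<open>P * X\<close>.\<close>

lemma sum_bessel:
  fixes g :: "'a \<Rightarrow> complex" and e :: "'b \<Rightarrow> 'a \<Rightarrow> complex"
  assumes "finite D" and "P > 0"
    and orth: "\<And>r s. r \<in> D \<Longrightarrow> s \<in> D \<Longrightarrow> (\<Sum>n\<in>A. e r n * cnj (e s n)) = (if r = s then of_real P else 0)"
  shows "(\<Sum>r\<in>D. (norm (\<Sum>n\<in>A. g n * e r n))\<^sup>2) \<le> P * (\<Sum>n\<in>A. (norm (g n))\<^sup>2)"
proof -
  define a where "a = (\<lambda>r. \<Sum>n\<in>A. g n * e r n)"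
  define X where "X = (\<Sum>r\<in>D. (norm (a r))\<^sup>2)"
  define y where "y = (\<lambda>n. \<Sum>r\<in>D. a r * cnj (e r n))"
  have gy: "(\<Sum>n\<in>A. g n * cnj (y n)) = of_real X"
  proof -
    have "(\<Sum>n\<in>A. g n * cnj (y n)) = (\<Sum>n\<in>A. \<Sum>r\<in>D. cnj (a r) * (g n * e r n))"
      by (simp add: y_def cnj_sum sum_distrib_left mult_ac)
    also have "\<dots> = (\<Sum>r\<in>D. cnj (a r) * a r)"
      by (subst sum.swap) (simp add: a_def sum_distrib_left)
    also have "\<dots> = of_real X"
      unfolding X_def of_real_sum complex_norm_square by (simp add: mult.commute)
    finally show ?thesis .
  qed
  have yy: "(\<Sum>n\<in>A. y n * cnj (y n)) = of_real (P * X)"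
  proof -
    have "(\<Sum>n\<in>A. y n * cnj (y n)) =
        (\<Sum>n\<in>A. \<Sum>r\<in>D. \<Sum>s\<in>D. (a r * cnj (a s)) * (e s n * cnj (e r n)))"
      by (simp add: y_def cnj_sum sum_product mult_ac)
    also have "\<dots> = (\<Sum>r\<in>D. \<Sum>n\<in>A. \<Sum>s\<in>D. (a r * cnj (a s)) * (e s n * cnj (e r n)))"
      by (rule sum.swap)
    also have "\<dots> = (\<Sum>r\<in>D. \<Sum>s\<in>D. (a r * cnj (a s)) * (\<Sum>n\<in>A. e s n * cnj (e r n)))"
      unfolding sum_distrib_left by (intro sum.cong refl sum.swap)
    also have "\<dots> = (\<Sum>r\<in>D. \<Sum>s\<in>D. if s = r then a r * cnj (a r) * of_real P else 0)"
      by (intro sum.cong refl) (simp add: orth)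
    also have "\<dots> = of_real (P * X)"
      using \<open>finite D\<close> unfolding X_def of_real_mult of_real_sum complex_norm_square
      by (simp add: sum_distrib_left mult_ac)
    finally show ?thesis .
  qed
  have "of_real (\<Sum>n\<in>A. (norm (of_real P * g n - y n))\<^sup>2) =
      (of_real P)\<^sup>2 * (\<Sum>n\<in>A. g n * cnj (g n)) - of_real P * (\<Sum>n\<in>A. g n * cnj (y n))
        - of_real P * cnj (\<Sum>n\<in>A. g n * cnj (y n)) + (\<Sum>n\<in>A. y n * cnj (y n))"
    unfolding of_real_sum complex_norm_square cnj_sum sum_distrib_left
      sum_subtractf [symmetric] sum.distrib [symmetric]
    by (intro sum.cong refl) (simp add: algebra_simps power2_eq_square)
  also have "\<dots> = complex_of_real (P\<^sup>2 * (\<Sum>n\<in>A. (norm (g n))\<^sup>2) - P * X)"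
    unfolding gy yy by (simp add: complex_norm_square [symmetric])
  finally have "(\<Sum>n\<in>A. (norm (of_real P * g n - y n))\<^sup>2) = P\<^sup>2 * (\<Sum>n\<in>A. (norm (g n))\<^sup>2) - P * X"
    unfolding of_real_eq_iff .
  moreover have "0 \<le> (\<Sum>n\<in>A. (norm (of_real P * g n - y n))\<^sup>2)"
    by (intro sum_nonneg) simp
  ultimately have "P * X \<le> P * (P * (\<Sum>n\<in>A. (norm (g n))\<^sup>2))"
    by (simp add: power2_eq_square mult_ac)
  with \<open>P > 0\<close> show ?thesis by (simp add: X_def a_def)
qed

text \<open>Each further block of length \<open>q\<close> carries one more factor \<open>w\<close>,
  so the block sums form a geometric progression. It serves twisted character sums, with
  \<open>w\<close> a root of unity, and periodic functions, with \<open>w = 1\<close>.\<close>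

lemma sum_quasi_periodic:
  fixes F :: "nat \<Rightarrow> 'a::comm_ring_1"
  assumes "\<And>n. F (n + q) = w * F n"
  shows "(\<Sum>n\<in>{1..q * t}. F n) = (\<Sum>s<t. w ^ s) * (\<Sum>n\<in>{1..q}. F n)"
proof (induction t)
  case (Suc t)
  have iter: "F (n + q * t) = w ^ t * F n" for n
  proof (induction t)
    case (Suc t)
    then show ?case using assms[of "n + q * t"] by (simp add: add_ac mult_ac)
  qed simp
  have "{1..q * Suc t} = {1..q * t} \<union> {1 + q * t..q + q * t}" by auto
  then have "(\<Sum>n\<in>{1..q * Suc t}. F n) = (\<Sum>n\<in>{1..q * t}. F n) + (\<Sum>n\<in>{1 + q * t..q + q * t}. F n)"
    by (simp only:) (rule sum.union_disjoint, auto)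
  also have "(\<Sum>n\<in>{1 + q * t..q + q * t}. F n) = (\<Sum>n\<in>{1..q}. F (n + q * t))"
    by (rule sum.shift_bounds_cl_nat_ivl)
  also have "\<dots> = w ^ t * (\<Sum>n\<in>{1..q}. F n)"
    by (simp add: iter sum_distrib_left)
  finally show ?case using Suc by (simp add: algebra_simps)
qed simp

lemma sum_periodic:
  fixes F :: "nat \<Rightarrow> 'a::comm_ring_1"
  assumes "\<And>n. F (n + q) = F n"
  shows "(\<Sum>n\<in>{1..q * t}. F n) = of_nat t * (\<Sum>n\<in>{1..q}. F n)"
  using sum_quasi_periodic[of F q 1 t] assms by simp

lemma periodic_mod_nat:
  assumes "\<And>n::nat. F (n + q) = F n"
  shows "F (n mod q) = F n"
proof -
  have "F (m + q * t) = F m" for m t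
    by (induction t) (simp_all add: assms add.assoc [symmetric] add.commute [of q] )
  from this[of "n mod q" "n div q"] show ?thesis by simp
qed

lemma sum_residues:
  fixes F :: "nat \<Rightarrow> 'a::comm_monoid_add"
  assumes "\<And>n. F (n + q) = F n" and "q > 0"
  shows "(\<Sum>n\<in>{1..q}. F n) = (\<Sum>n<q. F n)"
proof -
  have "(\<Sum>n\<in>{1..q}. F n) = F q + (\<Sum>n\<in>{1..<q}. F n)"
    using \<open>q > 0\<close> by (subst sum.last_plus) auto
  also have "F q = F 0" using assms(1)[of 0] by simp
  also have "F 0 + (\<Sum>n\<in>{1..<q}. F n) = (\<Sum>n<q. F n)"
    using \<open>q > 0\<close> by (simp add: lessThan_atLeast0 sum.atLeast_Suc_lessThan)
  finally show ?thesis .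
qed

lemma sum_residues_mult:
  fixes F :: "nat \<Rightarrow> 'a::comm_monoid_add"
  assumes "\<And>n. F (n + q) = F n" and "coprime m q" and "q > 0"
  shows "(\<Sum>n<q. F (m * n)) = (\<Sum>n<q. F n)"
proof -
  have inj: "inj_on (\<lambda>n. m * n mod q) {..<q}"
  proof (rule inj_onI)
    fix a b assume ab: "a \<in> {..<q}" "b \<in> {..<q}" "m * a mod q = m * b mod q"
    then have "[m * a = m * b] (mod q)" by (simp add: cong_def)
    then have "[a = b] (mod q)" using \<open>coprime m q\<close> cong_mult_lcancel_nat by blast
    with ab show "a = b" by (simp add: cong_def)
  qed
  have "bij_betw (\<lambda>n. m * n mod q) {..<q} {..<q}"
    unfolding bij_betw_def using inj endo_inj_surj[OF _ _ inj] \<open>q > 0\<close>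
    by (metis (no_types, lifting) finite_lessThan image_subset_iff lessThan_iff mod_less_divisor)
  from sum.reindex_bij_betw[OF this, of F] show ?thesis
    by (simp add: periodic_mod_nat[of F, OF assms(1)])
qed

definition unity_root :: "nat \<Rightarrow> complex" where
  "unity_root N = cis (2 * pi / N)"

lemma unity_root_mult_cnj: "unity_root N * cnj (unity_root N) = 1"
  by (simp add: unity_root_def cis_mult cis_cnj)

lemma unity_root_power_mult: "M > 0 \<Longrightarrow> unity_root (N * M) ^ M = unity_root N"
  by (simp add: unity_root_def Complex.DeMoivre)

lemma unity_root_power_self: "N > 0 \<Longrightarrow> unity_root N ^ N = 1"
  by (simp add: unity_root_def Complex.DeMoivre)

lemma unity_root_power_eq_1_iff:
  assumes "N > 0"
  shows "unity_root N ^ n = 1 \<longleftrightarrow> N dvd n"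
proof
  assume "N dvd n"
  then show "unity_root N ^ n = 1"
    using assms by (auto simp: power_mult unity_root_power_self)
next
  assume "unity_root N ^ n = 1"
  then have "cis (real n * (2 * pi / N)) = 1" by (simp add: unity_root_def Complex.DeMoivre)
  then have "cos (real n * (2 * pi / N)) = 1" by (metis cis.sel(1) one_complex.sel(1))
  then obtain k :: int where "real n * (2 * pi / N) = k * (2 * pi)"
    by (auto simp: cos_one_2pi_int)
  then have "real n = of_int k * real N" using assms by (simp add: field_simps)
  then have "int n = k * int N" by (metis of_int_eq_iff of_int_mult of_int_of_nat_eq)
  then show "N dvd n" by (metis dvd_triv_right int_dvd_int_iff)
qed

lemma unity_root_power_cong:
  assumes "N > 0" "m mod N = n mod N"
  shows "unity_root N ^ m = unity_root N ^ n"
proof -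
  have "unity_root N ^ m = unity_root N ^ (m mod N)" for m
    using periodic_mod_nat[of "\<lambda>m. unity_root N ^ m" N m] assms
    by (simp add: power_add unity_root_power_self)
  with assms show ?thesis by metis
qed

text \<open>A chord is at most as long as its arc. This bounds the factor lost in summation by
  parts.\<close>

lemma norm_1_minus_unity_root: "norm (1 - unity_root N) \<le> 2 * pi / N"
proof -
  have "norm (1 - unity_root N) = 2 * \<bar>sin ((2 * pi / N) / 2)\<bar>"
    using dist_exp_i_1[of "2 * pi / N"]
    by (simp add: unity_root_def cis_conv_exp norm_minus_commute)
  also have "\<dots> \<le> 2 * \<bar>(2 * pi / N) / 2\<bar>"
    using abs_sin_x_le_abs_x[of "(2 * pi / N) / 2"] by simp
  finally show ?thesis by simp
qed

lemma sum_power_root: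
  fixes z :: "'a::field"
  assumes "z ^ t = 1" "z \<noteq> 1"
  shows "(\<Sum>s<t. z ^ s) = 0"
  using assms by (simp add: geometric_sum)

text \<open>The ratio \<open>w\<close> of the two roots satisfies \<open>w ^ P = 1\<close>, so its
  powers sum to zero unless \<open>w = 1\<close>; that would give both roots the same order, hence
  \<open>M = N\<close>.\<close>

lemma unity_root_orthogonal:
  assumes "P > 0" "M dvd P" "N dvd P"
  shows "(\<Sum>n<P. unity_root M ^ n * cnj (unity_root N ^ n)) = (if M = N then of_nat P else 0)"
proof -
  define w where "w = unity_root M * cnj (unity_root N)"
  have pos: "M > 0" "N > 0" using assms by (auto intro: Nat.gr0I)
  have eq: "(\<Sum>n<P. unity_root M ^ n * cnj (unity_root N ^ n)) = (\<Sum>n<P. w ^ n)"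
    by (simp add: w_def power_mult_distrib)
  show ?thesis
  proof (cases "M = N")
    case True
    then show ?thesis unfolding eq by (simp add: w_def unity_root_mult_cnj)
  next
    case False
    have "w \<noteq> 1"
    proof
      assume "w = 1"
      then have "unity_root M = unity_root N"
        unfolding w_def using unity_root_mult_cnj[of N]
        by (metis mult.assoc mult.commute mult.right_neutral)
      then have "M dvd n \<longleftrightarrow> N dvd n" for n
        using pos by (simp flip: unity_root_power_eq_1_iff)
      then have "M = N" by (meson dvd_antisym dvd_refl)
      with False show False by simp
    qed
    moreover have "unity_root M ^ P = 1" "unity_root N ^ P = 1"
      using assms pos by (simp_all add: unity_root_power_eq_1_iff)
    then have "w ^ P = 1" by (simp add: w_def power_mult_distrib flip: complex_cnj_power)
    ultimately show ?thesis using False unfolding eq by (simp add: sum_power_root)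
  qed
qed

subsection \<open>Gauss sums of primitive characters\<close>

lemma completely_multiplicativeD:
  assumes "completely_multiplicative f"
  shows "f (m * n) = f m * f n" "f 1 = 1" "f (Suc 0) = 1"
  using assms by (auto simp: completely_multiplicative_def)

lemma completely_multiplicative_power:
  "completely_multiplicative f \<Longrightarrow> f (m ^ n) = f m ^ n"
  by (induction n) (simp_all add: completely_multiplicativeD)

lemma completely_multiplicative_prod:
  "completely_multiplicative f \<Longrightarrow> f (\<Prod>x\<in>A. g x) = (\<Prod>x\<in>A. f (g x))"
  by (induction A rule: infinite_finite_induct) (simp_all add: completely_multiplicativeD)

lemma completely_multiplicative_cong:
  assumes f: "completely_multiplicative f" and g: "completely_multiplicative g"
    and eq: "\<And>p. prime p \<Longrightarrow> p dvd n \<Longrightarrow> f p = g p" and "n > 0"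
  shows "f n = g n"
proof -
  have *: "h n = (\<Prod>p\<in>prime_factors n. h p ^ multiplicity p n)" if "completely_multiplicative h" for h
  proof -
    have "h n = h (\<Prod>p\<in>prime_factors n. p ^ multiplicity p n)"
      using \<open>n > 0\<close> by (simp add: prod_prime_factors)
    also have "\<dots> = (\<Prod>p\<in>prime_factors n. h p ^ multiplicity p n)"
      using that by (simp add: completely_multiplicative_prod completely_multiplicative_power)
    finally show ?thesis .
  qed
  show ?thesis
    unfolding *[OF f] *[OF g] by (intro prod.cong refl) (metis eq in_prime_factors_iff)
qed

definition gauss_sum :: "nat \<Rightarrow> (nat \<Rightarrow> complex) \<Rightarrow> nat \<Rightarrow> complex" where
  "gauss_sum q chi u = (\<Sum>n<q. chi n * unity_root q ^ (n * u))"

context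
  fixes q :: nat and chi :: "nat \<Rightarrow> complex"
  assumes char: "dirichlet_character q chi"
begin

lemma character_modulus_pos: "q > 0"
  using char by (simp add: dirichlet_character_def)

lemma character_cm: "completely_multiplicative chi"
  using char by (simp add: dirichlet_character_def)

lemma character_add_modulus: "chi (n + q) = chi n"
  using char by (simp add: dirichlet_character_def)

lemma character_eq_0_iff: "chi n = 0 \<longleftrightarrow> \<not> coprime n q"
  using char by (simp add: dirichlet_character_def)

lemma character_mod: "chi (n mod q) = chi n"
  by (rule periodic_mod_nat) (rule character_add_modulus)

lemma character_cong: "m mod q = n mod q \<Longrightarrow> chi m = chi n"
  by (metis character_mod)

text \<open>Euler's theorem makes \<open>chi n\<close> a root of unity.\<close>

lemma norm_character:
  assumes "coprime n q"
  shows "norm (chi n) = 1"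
proof -
  have "chi n ^ totient q = chi (n ^ totient q)"
    by (simp add: completely_multiplicative_power character_cm)
  also have "\<dots> = chi 1"
    using euler_theorem[OF assms] by (intro character_cong) (simp add: cong_def)
  finally have "chi n ^ totient q = 1" by (simp add: completely_multiplicativeD[OF character_cm])
  then have "norm (chi n) ^ totient q = 1" by (metis norm_one norm_power)
  then show ?thesis
    using power_eq_imp_eq_base[of "norm (chi n)" "totient q" 1] character_modulus_pos by simp
qed

lemma norm_character_le: "norm (chi n) \<le> 1"
  using norm_character[of n] character_eq_0_iff[of n] by (cases "coprime n q") auto

text \<open>Multiplication by the unit \<open>m\<close> permutes the residues modulo
  \<open>q\<close>, and \<open>chi m\<close> is absorbed by multiplicativity.\<close>

lemma gauss_sum_mult:
  assumes "coprime m q"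
  shows "chi m * gauss_sum q chi (m * u) = gauss_sum q chi u"
proof -
  define F where "F = (\<lambda>n. chi n * unity_root q ^ (n * u))"
  have F: "F (n + q) = F n" for n
    using character_modulus_pos
    by (simp add: F_def character_add_modulus add_mult_distrib power_add power_mult unity_root_power_self)
  have "chi m * gauss_sum q chi (m * u) = (\<Sum>n<q. F (m * n))"
    by (simp add: gauss_sum_def F_def sum_distrib_left completely_multiplicativeD[OF character_cm] mult_ac)
  also have "\<dots> = (\<Sum>n<q. F n)"
    by (rule sum_residues_mult) (use F assms character_modulus_pos in auto)
  finally show ?thesis by (simp add: gauss_sum_def F_def)
qed

lemma gauss_sum_coprime:
  assumes "coprime u q"
  shows "gauss_sum q chi u = cnj (chi u) * gauss_sum q chi 1"
proof -
  have "cnj (chi u) * chi u = 1"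
    using norm_character[OF assms] by (simp add: complex_norm_square[symmetric] mult.commute)
  then show ?thesis
    using gauss_sum_mult[OF assms, of 1] by (metis mult.assoc mult.left_neutral mult.right_neutral)
qed

text \<open>If \<open>m \<equiv> n\<close> modulo \<open>q / gcd u q\<close>, then \<open>m u \<equiv> n u\<close> modulo \<open>q\<close>, so \<open>chi m \<noteq> chi n\<close> forces
  the sum to vanish.\<close>
lemma gauss_sum_not_coprime:
  assumes prim: "primitive_character q chi" and "\<not> coprime u q"
  shows "gauss_sum q chi u = 0"
proof -
  define e where "e = gcd u q"
  define d where "d = q div e"
  have e: "e dvd u" "e dvd q" "e \<noteq> 1" "e > 0"
    using assms(2) character_modulus_pos by (auto simp: e_def coprime_iff_gcd_eq_1)
  then have q: "q = d * e" by (simp add: d_def)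
  with e character_modulus_pos have "d \<noteq> q" by auto
  with prim have "\<not> induced_modulus q chi d" by (auto simp: primitive_character_def)
  with q obtain m n where mn: "coprime m q" "coprime n q" "m mod d = n mod d" "chi m \<noteq> chi n"
    unfolding induced_modulus_def by auto
  from e obtain v where u: "u = e * v" by blast
  have "(m * u) mod q = (n * u) mod q"
  proof -
    have "(e * m) mod q = (e * n) mod q"
      using mn(3) by (simp add: q mult.commute[of d] mult_mod_right [symmetric])
    then have "(e * m * v) mod q = (e * n * v) mod q" by (metis mod_mult_left_eq)
    then show ?thesis by (simp add: u mult_ac)
  qed
  then have "gauss_sum q chi (m * u) = gauss_sum q chi (n * u)"
    unfolding gauss_sum_def using character_modulus_pos
    by (intro sum.cong refl arg_cong2[of _ _ _ _ "(*)"] unity_root_power_cong)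
      (simp_all, metis mod_mult_right_eq)
  moreover have "chi m * gauss_sum q chi (m * u) = chi n * gauss_sum q chi (n * u)"
    using mn by (simp add: gauss_sum_mult)
  ultimately have "gauss_sum q chi (m * u) = 0" using mn(4) by simp
  then show ?thesis using gauss_sum_mult[OF mn(1), of u] by simp
qed

lemma gauss_sum_primitive:
  assumes "primitive_character q chi"
  shows "gauss_sum q chi u = cnj (chi u) * gauss_sum q chi 1"
proof (cases "coprime u q")
  case False
  then have "chi u = 0" using character_eq_0_iff[of u] by simp
  with gauss_sum_not_coprime[OF assms False] show ?thesis by simp
qed (rule gauss_sum_coprime)

text \<open>Otherwise all Gauss sums vanish, contradicting Fourier inversion at \<open>n = 1\<close>.\<close>
lemma gauss_sum_1_nonzero:
  assumes "primitive_character q chi"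
  shows "gauss_sum q chi 1 \<noteq> 0"
proof
  assume "gauss_sum q chi 1 = 0"
  then have zero: "gauss_sum q chi u = 0" for u
    using gauss_sum_primitive[OF assms, of u] by simp
  \<comment> \<open>Orthogonality in \<open>u\<close> detects \<open>n\<close> congruent to 1;
    \<open>n + q - 1\<close> stands for \<open>n - 1\<close> without truncated subtraction, and
    \<open>1 mod q\<close> also covers \<open>q = 1\<close>.\<close>
  have inner: "(\<Sum>u<q. unity_root q ^ ((n + q - 1) * u)) = (if n mod q = 1 mod q then of_nat q else 0)" for n
  proof -
    have "q dvd n + q - 1 \<longleftrightarrow> n mod q = 1 mod q"
    proof -
      have "n + q - 1 = n + (q - 1)" using character_modulus_pos by simp
      moreover have "[n + (q - 1) = 0] (mod q) \<longleftrightarrow> [n + (q - 1) + 1 = 0 + 1] (mod q)"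
        by (rule cong_add_rcancel_nat [symmetric])
      moreover have "[n + (q - 1) + 1 = 0 + 1] (mod q) \<longleftrightarrow> n mod q = 1 mod q"
        using character_modulus_pos by (simp add: cong_def)
      ultimately show ?thesis by (simp add: cong_0_iff)
    qed
    moreover have "(unity_root q ^ (n + q - 1)) ^ q = 1"
      unfolding power_mult [symmetric] unity_root_power_eq_1_iff[OF character_modulus_pos] by simp
    ultimately show ?thesis
      using character_modulus_pos unity_root_power_eq_1_iff[of q "n + q - 1"]
      by (auto simp: power_mult sum_power_root)
  qed
  \<comment> \<open>Multiplying by \<open>unity_root q ^ ((q - 1) * u)\<close>, the conjugate of
    \<open>unity_root q ^ u\<close>, and summing over \<open>u\<close> isolates
    \<open>q * chi 1 = q\<close>.\<close>
  have "0 = (\<Sum>u<q. gauss_sum q chi u * unity_root q ^ ((q - 1) * u))"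
    by (simp add: zero)
  also have "\<dots> = (\<Sum>n<q. \<Sum>u<q. chi n * unity_root q ^ ((n + q - 1) * u))"
    unfolding gauss_sum_def sum_distrib_right using character_modulus_pos
    by (subst sum.swap) (simp add: distrib_left power_add mult_ac flip: add_diff_assoc)
  also have "\<dots> = (\<Sum>n<q. if n = 1 mod q then of_nat q * chi n else 0)"
    unfolding sum_distrib_left [symmetric] inner by (intro sum.cong refl) auto
  also have "\<dots> = of_nat q * chi (1 mod q)"
    using character_modulus_pos by simp
  also have "\<dots> = of_nat q" by (simp only: character_mod completely_multiplicativeD[OF character_cm])  simp
  finally show False using character_modulus_pos by simp
qed

text \<open>Grouping \<open>m\<close> into blocks of length \<open>q\<close> yields a geometric sum of ratio \<open>e(d / D)\<close>.\<close>
lemma twisted_character_sum: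
  assumes prim: "primitive_character q chi" and "D dvd R" "d dvd R" "R > 0"
  shows "(\<Sum>m\<in>{1..q * (R div d)}. chi m * unity_root (q * D) ^ (d * m)) =
    (if D dvd d then of_nat (R div d) * cnj (chi (d div D)) * gauss_sum q chi 1 else 0)"
proof -
  define z where "z = unity_root (q * D)"
  define F where "F = (\<lambda>m. chi m * z ^ (d * m))"
  define w where "w = unity_root D ^ d"
  have "D > 0" using assms by (auto intro: Nat.gr0I)
  have zq: "z ^ q = unity_root D"
    using unity_root_power_mult[of q D] character_modulus_pos by (simp add: z_def mult.commute)
  have F: "F (n + q) = w * F n" for n
  proof -
    have "z ^ (d * (n + q)) = z ^ (d * n) * (z ^ q) ^ d"
      by (simp add: algebra_simps power_add power_mult [symmetric])
    then show ?thesis by (simp add: F_def w_def zq character_add_modulus)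
  qed
  have main: "(\<Sum>m\<in>{1..q * (R div d)}. F m) = (\<Sum>s<R div d. w ^ s) * (\<Sum>n\<in>{1..q}. F n)"
    by (rule sum_quasi_periodic) (rule F)
  show ?thesis
  proof (cases "D dvd d")
    case True
    then obtain c where c: "d = D * c" by blast
    have w: "w = 1" using \<open>D > 0\<close> by (simp add: w_def c power_mult unity_root_power_self)
    have zD: "z ^ D = unity_root q" using \<open>D > 0\<close> by (simp add: z_def unity_root_power_mult)
    have "(\<Sum>n\<in>{1..q}. F n) = (\<Sum>n<q. F n)"
      by (rule sum_residues) (use F w character_modulus_pos in auto)
    also have "\<dots> = gauss_sum q chi c"
      unfolding gauss_sum_def F_def
      by (intro sum.cong refl) (simp add: c zD [symmetric] power_mult [symmetric] mult_ac)
    finally show ?thesis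
      using True main gauss_sum_primitive[OF prim, of c] \<open>D > 0\<close> by (simp add: F_def z_def w c)
  next
    case False
    have "w \<noteq> 1" using False \<open>D > 0\<close> by (simp add: w_def unity_root_power_eq_1_iff)
    \<comment> \<open>The exponent of \<open>unity_root D\<close> is
      \<open>d * (R div d) = R\<close>, a multiple of \<open>D\<close>, so the geometric sum over
      all blocks vanishes.\<close>
    moreover have "w ^ (R div d) = 1"
      using assms \<open>D > 0\<close> by (simp add: w_def unity_root_power_eq_1_iff flip: power_mult)
    ultimately show ?thesis using False main by (simp add: sum_power_root F_def z_def)
  qed
qed

end

subsection \<open>Truncated Euler factors\<close>

lemma sum_multiples:
  fixes F :: "nat \<Rightarrow> 'a::comm_monoid_add"
  assumes "d > 0"
  shows "(\<Sum>n\<in>{1..x}. if d dvd n then F n else 0) = (\<Sum>m\<in>{1..x div d}. F (d * m))"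
proof -
  have "(\<Sum>n\<in>{1..x}. if d dvd n then F n else 0) = (\<Sum>n | n \<in> {1..x} \<and> d dvd n. F n)"
    by (simp add: sum.If_cases Int_def)
  also have "\<dots> = (\<Sum>m\<in>{1..x div d}. F (d * m))"
  proof (rule sum.reindex_bij_witness[of _ "\<lambda>m. d * m" "\<lambda>n. n div d"])
    fix m assume "m \<in> {1..x div d}"
    then have "d * m \<le> d * (x div d)" "d * m \<ge> 1" using assms by (auto simp: Suc_le_eq)
    moreover have "d * (x div d) \<le> x" by (rule times_div_less_eq_dividend)
    ultimately have "d * m \<le> x" by linarith
    with \<open>d * m \<ge> 1\<close> show "d * m \<in> {n. n \<in> {1..x} \<and> d dvd n}" by simp
  qed (use assms in \<open>auto simp: div_le_mono Suc_le_eq elim!: dvdE\<close>)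
  finally show ?thesis .
qed

text \<open>Abel summation with \<open>h n = H n - H (n - 1)\<close>. The boundary term is
  \<open>H P * z ^ P\<close>, which vanishes by assumption, so Fourier coefficients of
  \<open>h\<close> become those of its summatory function.\<close>

lemma sum_by_parts_root:
  fixes h H :: "nat \<Rightarrow> 'a::comm_ring_1"
  assumes "\<And>x. H x = (\<Sum>n\<in>{1..x}. h n)" and "H P = 0"
  shows "(\<Sum>n\<in>{1..P}. h n * z ^ n) = (1 - z) * (\<Sum>n<P. H n * z ^ n)"
proof -
  have "(\<Sum>n\<in>{1..x}. h n * z ^ n) = (1 - z) * (\<Sum>n<x. H n * z ^ n) + H x * z ^ x" for x
  proof (induction x)
    case (Suc x)
    have "H (Suc x) = H x + h (Suc x)" by (simp add: assms(1))
    then show ?case using Suc by (simp add: algebra_simps)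
  qed (simp add: assms(1))
  then show ?thesis using assms(2) by simp
qed

text \<open>With \<open>g (p ^ j) = euler_coeff (f p) (chi p) N j\<close> one has the Euler factor identity
  \<open>(1 - f(p)\<^sup>N T\<^sup>N) / (1 - f(p) T) = (\<Sum>j\<le>N. g (p ^ j) T\<^sup>j) / (1 - chi(p) T)\<close>.\<close>
definition euler_coeff :: "'a::comm_ring_1 \<Rightarrow> 'a \<Rightarrow> nat \<Rightarrow> nat \<Rightarrow> 'a" where
  "euler_coeff a b N j =
    (if j = 0 then 1 else if j = N then - b * a ^ (N - 1) else a ^ j - b * a ^ (j - 1))"

text \<open>This is the coefficient of \<open>T ^ v\<close> in the Euler factor identity.\<close>

lemma euler_coeff_convolution:
  assumes "N > 0"
  shows "(\<Sum>j\<in>{0..N}. euler_coeff a b N j * (if j \<le> v then b ^ (v - j) else 0)) =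
    (if v < N then a ^ v else 0)"
proof -
  \<comment> \<open>The partial sums telescope; for \<open>v \<ge> N\<close> the special coefficient
    at \<open>j = N\<close> cancels what is left after \<open>j = N - 1\<close>.\<close>
  have partial: "(\<Sum>j\<in>{0..M}. euler_coeff a b N j * b ^ (v - j)) = a ^ M * b ^ (v - M)"
    if "M < N" "M \<le> v" for M
    using that
  proof (induction M)
    case (Suc M)
    then have "b ^ (v - M) = b * b ^ (v - Suc M)" by (simp add: Suc_diff_Suc flip: power_Suc)
    with Suc show ?case by (simp add: euler_coeff_def algebra_simps)
  qed (simp add: euler_coeff_def)
  show ?thesis
  proof (cases "v < N")
    case True
    then have "(\<Sum>j\<in>{0..N}. euler_coeff a b N j * (if j \<le> v then b ^ (v - j) else 0)) =
      (\<Sum>j\<in>{0..v}. euler_coeff a b N j * b ^ (v - j))"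
      by (intro sum.mono_neutral_cong_right) auto
    with True partial[of v] show ?thesis by simp
  next
    case False
    obtain M where M: "N = Suc M" using assms by (cases N) auto
    have "b ^ (v - M) = b * b ^ (v - Suc M)" using False M by (simp add: Suc_diff_Suc flip: power_Suc)
    then show ?thesis using False M partial[of M] by (simp add: euler_coeff_def)
  qed
qed

text \<open>Since \<open>i \<ge> 1\<close>, the exceptional coefficient at \<open>j = 0\<close> does
  not enter. All others except the last contain the factor \<open>a - b\<close>, so the sum is
  essentially \<open>a - b\<close> times a geometric series of ratio \<open>z\<close>, with
  \<open>norm z \<le> 1/2\<close>. The margin \<open>L\<close> keeps the last term from cancelling
  it.\<close>

lemma norm_euler_factor_ge:
  fixes a b :: complex and p :: nat
  assumes a: "norm a = 1" and b: "norm b \<le> 1" and p: "p \<ge> 2" and i: "1 \<le> i" "i + L \<le> N" "L > 0"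
    and \<delta>: "\<delta> \<le> norm (a - b)" "4 * (1/2) ^ L \<le> \<delta>"
  shows "\<delta> / 3 / real p ^ i \<le>
    norm (\<Sum>j\<in>{0..N}. euler_coeff a b N j * (if i \<le> j then cnj b ^ (j - i) / of_nat p ^ j else 0))"
proof -
  define T where "T = (\<Sum>j\<in>{0..N}. euler_coeff a b N j * (if i \<le> j then cnj b ^ (j - i) / of_nat p ^ j else 0))"
  define z where "z = a * cnj b / of_nat p"
  define M where "M = N - i"
  have N: "N = i + M" and "M \<ge> L" using i by (auto simp: M_def)
  obtain i' where i': "i = Suc i'" using i by (cases i) auto
  have T1: "T = (\<Sum>l\<in>{0..M}. euler_coeff a b N (l + i) * (cnj b ^ l / of_nat p ^ (l + i)))"
  proof -
    have "T = (\<Sum>j\<in>{0 + i..M + i}. euler_coeff a b N j * (cnj b ^ (j - i) / of_nat p ^ j))"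
      unfolding T_def by (intro sum.mono_neutral_cong_right) (auto simp: N)
    then show ?thesis by (simp only: sum.shift_bounds_cl_nat_ivl) simp
  qed
  have low: "euler_coeff a b N (l + i) * (cnj b ^ l / of_nat p ^ (l + i)) =
      a ^ i' * (a - b) * z ^ l / of_nat p ^ i" if "l < M" for l
    using that N by (simp add: euler_coeff_def i' z_def power_add power_divide power_mult_distrib field_simps)
  have high: "euler_coeff a b N (M + i) * (cnj b ^ M / of_nat p ^ (M + i)) =
      - (a ^ i' * b * z ^ M / of_nat p ^ i)"
    using N by (simp add: euler_coeff_def i' z_def power_add power_divide power_mult_distrib field_simps)
  have "T = (\<Sum>l<M. a ^ i' * (a - b) * z ^ l / of_nat p ^ i) - a ^ i' * b * z ^ M / of_nat p ^ i"
    unfolding T1 using high low by (simp add: atLeast0AtMost lessThan_Suc_atMost [symmetric])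
  also have "\<dots> = a ^ i' * ((a - b) * (\<Sum>l<M. z ^ l) - b * z ^ M) / of_nat p ^ i"
    by (simp add: sum_distrib_left sum_divide_distrib [symmetric] mult_ac right_diff_distrib diff_divide_distrib)
  finally have T2: "T = a ^ i' * ((a - b) * (\<Sum>l<M. z ^ l) - b * z ^ M) / of_nat p ^ i" .
  define B where "B = (a - b) * (\<Sum>l<M. z ^ l) - b * z ^ M"
  \<comment> \<open>Multiplying by \<open>1 - z\<close> clears the geometric series and leaves
    \<open>a - b\<close> with an error of order \<open>z ^ M\<close>.\<close>
  have "(1 - z) * B = (a - b) * ((1 - z) * (\<Sum>l<M. z ^ l)) - b * z ^ M * (1 - z)"
    by (simp add: B_def algebra_simps)
  also have "\<dots> = (a - b) - z ^ M * (a - b * z)"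
    by (simp only: one_diff_power_eq [symmetric]) (simp add: algebra_simps)
  finally have B: "(1 - z) * B = (a - b) - z ^ M * (a - b * z)" .
  have z: "norm z \<le> 1 / 2"
    using a b p by (simp add: z_def norm_mult norm_divide divide_simps)
  have "norm (z ^ M * (a - b * z)) \<le> (1/2) ^ L * 2"
  proof -
    have "norm (z ^ M) \<le> (1/2) ^ M" using z by (simp add: norm_power power_mono)
    also have "\<dots> \<le> (1/2) ^ L" using \<open>M \<ge> L\<close> by (intro power_decreasing) auto
    finally have 1: "norm (z ^ M) \<le> (1/2) ^ L" .
    have "norm (b * z) \<le> 1" using mult_mono[OF b z] by (simp add: norm_mult)
    then have 2: "norm (a - b * z) \<le> 2" using norm_triangle_ineq4[of a "b * z"] a by simp
    show ?thesis unfolding norm_mult using 1 2 by (intro mult_mono) auto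
  qed
  \<comment> \<open>The error is at most \<open>2 * (1/2) ^ L \<le> \<delta> / 2\<close>; dividing
    by \<open>norm (1 - z) \<le> 3/2\<close> then produces the constant
    \<open>\<delta> / 3\<close>.\<close>
  then have "\<delta> / 2 \<le> norm ((1 - z) * B)"
    unfolding B using \<delta> norm_triangle_ineq2[of "a - b" "z ^ M * (a - b * z)"] by simp
  also have "\<dots> \<le> 3 / 2 * norm B"
    unfolding norm_mult using z norm_triangle_ineq4[of 1 z] by (intro mult_right_mono) auto
  finally have "\<delta> / 3 \<le> norm B" by simp
  moreover have "norm T = norm B / real p ^ i"
    using a by (simp add: T2 B_def norm_mult norm_divide norm_power)
  ultimately show ?thesis
    unfolding T_def [symmetric] by (metis divide_right_mono of_nat_0_le_iff zero_le_power)
qed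

subsection \<open>The truncated function and its Fourier coefficients\<close>

locale unimodular_modification =
  fixes chi f :: "nat \<Rightarrow> complex" and q :: nat and S :: "nat set"
  assumes primitive: "primitive_character q chi"
    and finite_S [simp]: "finite S"
    and prime_S: "p \<in> S \<Longrightarrow> prime p"
    and cm_f: "completely_multiplicative f"
    and f_eq_chi: "prime p \<Longrightarrow> p \<notin> S \<Longrightarrow> f p = chi p"
    and f_neq_chi: "p \<in> S \<Longrightarrow> f p \<noteq> chi p"
    and norm_f: "p \<in> S \<Longrightarrow> norm (f p) = 1"
begin

lemma char: "dirichlet_character q chi"
  using primitive by (simp add: primitive_character_def)

lemmas cm_chi = character_cm[OF char]
lemmas q_pos = character_modulus_pos[OF char]
lemmas chi_mult = completely_multiplicativeD(1)[OF cm_chi]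
lemmas f_mult = completely_multiplicativeD(1)[OF cm_f]

lemma f_eq_chi_coprime:
  assumes "m > 0" "\<And>p. p \<in> S \<Longrightarrow> \<not> p dvd m"
  shows "f m = chi m"
  by (rule completely_multiplicative_cong[OF cm_f cm_chi _ assms(1)]) (use assms f_eq_chi in blast)

text \<open>Indexing by exponent vectors makes the divisors of the product of all
  \<open>p ^ N\<close> a product set, so sums over them factor into sums over the individual
  exponents.\<close>

definition smooth :: "(nat \<Rightarrow> nat) \<Rightarrow> nat" where
  "smooth J = (\<Prod>p\<in>S. p ^ J p)"

lemma smooth_pos: "smooth J > 0"
  unfolding smooth_def by (intro prod_pos) (auto dest: prime_S prime_gt_0_nat)

lemma multiplicity_smooth: "prime p \<Longrightarrow> multiplicity p (smooth J) = (if p \<in> S then J p else 0)"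
  unfolding smooth_def by (rule multiplicity_prod_prime_powers) (auto intro: prime_S)

lemma smooth_dvd_iff: "smooth J dvd n \<longleftrightarrow> (\<forall>p\<in>S. p ^ J p dvd n)"
proof (cases "n = 0")
  case False
  show ?thesis
  proof
    assume "smooth J dvd n"
    moreover have "p ^ J p dvd smooth J" if "p \<in> S" for p
      unfolding smooth_def using that by (intro dvd_prodI) auto
    ultimately show "\<forall>p\<in>S. p ^ J p dvd n" using dvd_trans by blast
  next
    assume "\<forall>p\<in>S. p ^ J p dvd n"
    then have "J p \<le> multiplicity p n" if "p \<in> S" for p
      using that False prime_S[OF that] by (intro multiplicity_geI) auto
    then show "smooth J dvd n"
      using smooth_pos[of J] by (intro multiplicity_le_imp_dvd) (auto simp: multiplicity_smooth)
  qed
qed simp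

lemma smooth_dvd_smooth_iff: "smooth I dvd smooth J \<longleftrightarrow> (\<forall>p\<in>S. I p \<le> J p)"
proof -
  have "p ^ I p dvd smooth J \<longleftrightarrow> I p \<le> J p" if "p \<in> S" for p
    using that prime_S[OF that] smooth_pos[of J]
    by (subst power_dvd_iff_le_multiplicity) (auto simp: multiplicity_smooth)
  then show ?thesis unfolding smooth_dvd_iff by (rule ball_cong [OF refl])
qed

lemma smooth_split: "(\<And>p. p \<in> S \<Longrightarrow> I p \<le> J p) \<Longrightarrow> smooth J = smooth I * smooth (\<lambda>p. J p - I p)"
  unfolding smooth_def by (simp add: prod.distrib [symmetric] power_add [symmetric])

lemma cm_smooth:
  "completely_multiplicative h \<Longrightarrow> h (smooth J) = (\<Prod>p\<in>S. h p ^ J p)"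
  unfolding smooth_def by (simp add: completely_multiplicative_prod completely_multiplicative_power)

definition trunc_coeff :: "nat \<Rightarrow> (nat \<Rightarrow> nat) \<Rightarrow> complex" where
  "trunc_coeff N J = (\<Prod>p\<in>S. euler_coeff (f p) (chi p) N (J p))"

text \<open>The convolution form makes periodicity and Fourier coefficients accessible; that it is a
  truncation of \<open>f\<close> is recovered in \<open>trunc_eq\<close>.\<close>

definition trunc :: "nat \<Rightarrow> nat \<Rightarrow> complex" where
  "trunc N n = (\<Sum>J\<in>PiE S (\<lambda>_. {0..N}).
    trunc_coeff N J * (if smooth J dvd n then chi (n div smooth J) else 0))"

text \<open>Write \<open>n = smooth v * m\<close> with no prime of \<open>S\<close> dividing
  \<open>m\<close>. Then \<open>f m = chi m\<close>, and the sum over exponent vectors splits into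
  one \<open>euler_coeff_convolution\<close> for each prime of \<open>S\<close>.\<close>

lemma trunc_eq:
  assumes "N > 0" "n > 0"
  shows "trunc N n = (if \<exists>p\<in>S. p ^ N dvd n then 0 else f n)"
proof -
  define v where "v = (\<lambda>p. multiplicity p n)"
  have "smooth v dvd n" by (auto simp: smooth_dvd_iff v_def multiplicity_dvd)
  then obtain m where n: "n = smooth v * m" by blast
  have pow_dvd: "p ^ j dvd n \<longleftrightarrow> j \<le> v p" if "p \<in> S" for p j
    unfolding v_def using assms prime_S[OF that] by (subst power_dvd_iff_le_multiplicity) auto
  have "m > 0" using assms n by (auto intro: Nat.gr0I)
  have "\<not> p dvd m" if "p \<in> S" for p
  proof
    assume "p dvd m"
    moreover have "p ^ v p dvd smooth v" using that smooth_dvd_iff[of v "smooth v"] by simp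
    ultimately have "p ^ Suc (v p) dvd n" 
      unfolding n power_Suc2 by (rule mult_dvd_mono [rotated])
    then show False unfolding pow_dvd[OF that] by simp
  qed
  then have fm: "f m = chi m" using \<open>m > 0\<close> f_eq_chi_coprime by blast
  have term_eq: "(if smooth J dvd n then chi (n div smooth J) else 0) =
      chi m * (\<Prod>p\<in>S. if J p \<le> v p then chi p ^ (v p - J p) else 0)" for J
  proof (cases "\<forall>p\<in>S. J p \<le> v p")
    case True
    then have "n = smooth J * (smooth (\<lambda>p. v p - J p) * m)"
      unfolding n by (subst smooth_split[of J v]) (auto simp: mult_ac)
    then have "chi (n div smooth J) = chi m * chi (smooth (\<lambda>p. v p - J p))"
      using smooth_pos[of J] by (simp add: chi_mult)
    moreover have "smooth J dvd n" using True by (auto simp: smooth_dvd_iff pow_dvd)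
    ultimately show ?thesis using True by (simp add: cm_smooth[OF cm_chi] cong: prod.cong)
  next
    case False
    then have "\<not> smooth J dvd n" by (auto simp: smooth_dvd_iff pow_dvd)
    moreover have "(\<Prod>p\<in>S. if J p \<le> v p then chi p ^ (v p - J p) else 0) = 0"
      using False by (intro prod_zero) auto
    ultimately show ?thesis by simp
  qed
  have "trunc N n = chi m * (\<Sum>J\<in>PiE S (\<lambda>_. {0..N}). \<Prod>p\<in>S.
      euler_coeff (f p) (chi p) N (J p) * (if J p \<le> v p then chi p ^ (v p - J p) else 0))"
    unfolding trunc_def trunc_coeff_def term_eq sum_distrib_left
    by (intro sum.cong refl) (simp add: prod.distrib mult_ac)
  also have "\<dots> = chi m * (\<Prod>p\<in>S. \<Sum>j\<in>{0..N}.
      euler_coeff (f p) (chi p) N j * (if j \<le> v p then chi p ^ (v p - j) else 0))"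
    by (subst prod_sum_PiE) auto
  also have "\<dots> = chi m * (\<Prod>p\<in>S. if v p < N then f p ^ v p else 0)"
    by (simp only: euler_coeff_convolution[OF assms(1)])
  finally have trunc: "trunc N n = chi m * (\<Prod>p\<in>S. if v p < N then f p ^ v p else 0)" .
  show ?thesis
  proof (cases "\<exists>p\<in>S. p ^ N dvd n")
    case True
    then obtain p where "p \<in> S" "\<not> v p < N" by (auto simp: pow_dvd not_less)
    then have "(\<Prod>p\<in>S. if v p < N then f p ^ v p else 0) = 0"
      by (intro prod_zero bexI[of _ p]) auto
    with True trunc show ?thesis by simp
  next
    case False
    then have "(\<Prod>p\<in>S. if v p < N then f p ^ v p else 0) = f (smooth v)"
      unfolding cm_smooth[OF cm_f] by (intro prod.cong) (auto simp: pow_dvd not_le)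
    with False trunc fm show ?thesis by (simp add: n f_mult mult_ac)
  qed
qed

text \<open>Every \<open>smooth J\<close> in the sum divides \<open>smooth (\<lambda>_. N)\<close>,
  so the shift moves \<open>n div smooth J\<close> by a multiple of \<open>q\<close>.\<close>

lemma trunc_periodic: "trunc N (n + q * smooth (\<lambda>_. N)) = trunc N n"
  unfolding trunc_def
proof (intro sum.cong refl arg_cong2[of _ _ _ _ "(*)"])
  fix J assume "J \<in> PiE S (\<lambda>_. {0..N})"
  then have "smooth J dvd smooth (\<lambda>_. N)" by (auto simp: smooth_dvd_smooth_iff PiE_iff)
  then obtain c where c: "smooth (\<lambda>_. N) = smooth J * c" by blast
  have chi: "chi (x + q * c) = chi x" for x
    by (rule character_cong[OF char]) simp
  have eq: "n + q * smooth (\<lambda>_. N) = n + smooth J * (q * c)" by (simp add: c)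
  show "(if smooth J dvd n + q * smooth (\<lambda>_. N) then chi ((n + q * smooth (\<lambda>_. N)) div smooth J) else 0) =
    (if smooth J dvd n then chi (n div smooth J) else 0)"
    unfolding eq using smooth_pos[of J] by (simp add: chi dvd_add_left_iff)
qed

text \<open>For fixed \<open>J\<close>, \<open>twisted_character_sum\<close> with
  \<open>d = smooth J\<close> gives zero unless \<open>smooth I\<close> divides
  \<open>smooth J\<close>, and otherwise a product over \<open>S\<close>. Summing over
  \<open>J\<close> yields an Euler product.\<close>

lemma trunc_fourier:
  assumes "\<And>p. p \<in> S \<Longrightarrow> I p \<le> N"
  shows "(\<Sum>n\<in>{1..q * smooth (\<lambda>_. N)}. trunc N n * unity_root (q * smooth I) ^ n) =
    of_nat (smooth (\<lambda>_. N)) * gauss_sum q chi 1 * (\<Prod>p\<in>S. \<Sum>j\<in>{0..N}.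
      euler_coeff (f p) (chi p) N j * (if I p \<le> j then cnj (chi p) ^ (j - I p) / of_nat p ^ j else 0))"
proof -
  define R where "R = smooth (\<lambda>_. N)"
  define D where "D = smooth I"
  define z where "z = unity_root (q * D)"
  define G where "G = gauss_sum q chi 1"
  have "R > 0" by (simp add: R_def smooth_pos)
  have "D dvd R" using assms by (simp add: D_def R_def smooth_dvd_smooth_iff)
  have inner: "(\<Sum>n\<in>{1..q * R}. (if smooth J dvd n then chi (n div smooth J) else 0) * z ^ n) =
      of_nat R * G * (\<Prod>p\<in>S. if I p \<le> J p then cnj (chi p) ^ (J p - I p) / of_nat p ^ J p else 0)"
    if J: "J \<in> PiE S (\<lambda>_. {0..N})" for J
  proof -
    define d where "d = smooth J"
    have "d > 0" by (simp add: d_def smooth_pos)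
    have dR: "d dvd R" using J by (auto simp: d_def R_def smooth_dvd_smooth_iff PiE_iff)
    then have "q * R div d = q * (R div d)" by (simp add: div_mult_swap)
    have "(\<Sum>n\<in>{1..q * R}. (if d dvd n then chi (n div d) else 0) * z ^ n) =
        (\<Sum>n\<in>{1..q * R}. if d dvd n then chi (n div d) * z ^ n else 0)"
      by (intro sum.cong) auto
    also have "\<dots> = (\<Sum>m\<in>{1..q * (R div d)}. chi m * z ^ (d * m))"
      using \<open>d > 0\<close> \<open>q * R div d = q * (R div d)\<close> by (subst sum_multiples) simp_all
    also have "\<dots> = (if D dvd d then of_nat (R div d) * cnj (chi (d div D)) * G else 0)"
      unfolding z_def G_def by (rule twisted_character_sum[OF char primitive \<open>D dvd R\<close> dR \<open>R > 0\<close>])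
    also have "\<dots> = of_nat R * G * (\<Prod>p\<in>S. if I p \<le> J p then cnj (chi p) ^ (J p - I p) / of_nat p ^ J p else 0)"
    proof (cases "D dvd d")
      case True
      then have IJ: "\<forall>p\<in>S. I p \<le> J p" by (simp add: D_def d_def smooth_dvd_smooth_iff)
      then have "d = D * smooth (\<lambda>p. J p - I p)" unfolding d_def D_def by (intro smooth_split) simp
      then have "chi (d div D) = (\<Prod>p\<in>S. chi p ^ (J p - I p))"
        using smooth_pos[of I] by (simp add: D_def cm_smooth[OF cm_chi])
      moreover have "complex_of_nat (R div d) = of_nat R / (\<Prod>p\<in>S. of_nat p ^ J p)"
      proof -
        obtain c where c: "R = d * c" using dR by blast
        have "complex_of_nat d = (\<Prod>p\<in>S. of_nat p ^ J p)" by (simp add: d_def smooth_def)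
        from this [symmetric] show ?thesis using \<open>d > 0\<close> by (simp add: c)
      qed
      ultimately show ?thesis using True IJ by (simp add: prod_dividef cong: prod.cong)
    next
      case False
      then have "(\<Prod>p\<in>S. if I p \<le> J p then cnj (chi p) ^ (J p - I p) / of_nat p ^ J p else 0) = 0"
        by (intro prod_zero) (auto simp: D_def d_def smooth_dvd_smooth_iff)
      with False show ?thesis by (simp only: if_False mult_zero_right)
    qed
    finally show ?thesis unfolding d_def .
  qed
  have "(\<Sum>n\<in>{1..q * R}. trunc N n * z ^ n) = (\<Sum>J\<in>PiE S (\<lambda>_. {0..N}). trunc_coeff N J *
      (\<Sum>n\<in>{1..q * R}. (if smooth J dvd n then chi (n div smooth J) else 0) * z ^ n))"
    unfolding trunc_def sum_distrib_right sum_distrib_left by (subst sum.swap) (simp add: mult_ac)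
  also have "\<dots> = (\<Sum>J\<in>PiE S (\<lambda>_. {0..N}). trunc_coeff N J *
      (of_nat R * G * (\<Prod>p\<in>S. if I p \<le> J p then cnj (chi p) ^ (J p - I p) / of_nat p ^ J p else 0)))"
    by (intro sum.cong refl) (simp only: inner)
  also have "\<dots> = of_nat R * G * (\<Sum>J\<in>PiE S (\<lambda>_. {0..N}). \<Prod>p\<in>S. euler_coeff (f p) (chi p) N (J p) *
      (if I p \<le> J p then cnj (chi p) ^ (J p - I p) / of_nat p ^ J p else 0))"
    unfolding sum_distrib_left
    by (intro sum.cong refl) (simp only: trunc_coeff_def prod.distrib mult_ac)
  also have "\<dots> = of_nat R * G * (\<Prod>p\<in>S. \<Sum>j\<in>{0..N}. euler_coeff (f p) (chi p) N j *
      (if I p \<le> j then cnj (chi p) ^ (j - I p) / of_nat p ^ j else 0))"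
    by (subst prod_sum_PiE) auto
  finally show ?thesis by (simp only: R_def G_def z_def D_def)
qed

section \<open>Comparison with the partial sums of \<open>f\<close>, and large Fourier
  coefficients\<close>

abbreviation period :: "nat \<Rightarrow> nat" where
  "period N \<equiv> q * smooth (\<lambda>_. N)"

definition trunc_sum :: "nat \<Rightarrow> nat \<Rightarrow> complex" where
  "trunc_sum N x = (\<Sum>n\<in>{1..x}. trunc N n)"

lemma period_pos: "period N > 0"
  using q_pos smooth_pos by simp

text \<open>By \<open>trunc_eq\<close>, truncation multiplies \<open>f n\<close> by the product of
  \<open>1 - g p\<close>, with \<open>g p\<close> the indicator of \<open>p ^ N dvd n\<close>; the
  formula is its expansion.\<close>

lemma trunc_inclusion_exclusion:
  assumes "N > 0" "n > 0"
  shows "trunc N n = (\<Sum>T\<in>Pow S. (-1) ^ card T * (if (\<Prod>p\<in>T. p ^ N) dvd n then f n else 0))"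
proof -
  define g where "g = (\<lambda>p. if p ^ N dvd n then 1 else 0 :: complex)"
  have g: "(\<Prod>p\<in>T. g p) = (if (\<Prod>p\<in>T. p ^ N) dvd n then 1 else 0)" if "T \<subseteq> S" for T
  proof -
    have "finite T" using that finite_S by (rule finite_subset)
    have "(\<Prod>p\<in>T. p ^ N) = smooth (\<lambda>p. if p \<in> T then N else 0)"
      unfolding smooth_def using that by (intro prod.mono_neutral_cong_left) auto
    then have "(\<Prod>p\<in>T. p ^ N) dvd n \<longleftrightarrow> (\<forall>p\<in>T. p ^ N dvd n)"
      using that by (auto simp: smooth_dvd_iff)
    then show ?thesis using \<open>finite T\<close> by (auto simp: g_def prod_zero_iff)
  qed
  have "trunc N n = f n * (\<Prod>p\<in>S. 1 - g p)"
    using trunc_eq[OF assms] by (auto simp: g_def prod_zero_iff)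
  also have "(\<Prod>p\<in>S. 1 - g p) = (\<Sum>T\<in>Pow S. (-1) ^ card T * (\<Prod>p\<in>T. g p))"
    by (subst prod_diff_conv_sum) auto
  also have "f n * \<dots> = (\<Sum>T\<in>Pow S. (-1) ^ card T * (if (\<Prod>p\<in>T. p ^ N) dvd n then f n else 0))"
    unfolding sum_distrib_left by (intro sum.cong refl) (simp add: g)
  finally show ?thesis .
qed

lemma norm_trunc_sum_le:
  assumes "N > 0" and B: "\<And>y. y \<le> x \<Longrightarrow> norm (\<Sum>n\<in>{1..y}. f n) \<le> B"
  shows "norm (trunc_sum N x) \<le> 2 ^ card S * B"
proof -
  define e where "e = (\<lambda>T. \<Prod>p\<in>T. p ^ N :: nat)"
  have "trunc_sum N x = (\<Sum>n\<in>{1..x}. \<Sum>T\<in>Pow S. (-1) ^ card T * (if e T dvd n then f n else 0))"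
    unfolding trunc_sum_def e_def
    by (intro sum.cong refl trunc_inclusion_exclusion[OF \<open>N > 0\<close>]) simp
  also have "\<dots> = (\<Sum>T\<in>Pow S. (-1) ^ card T * (\<Sum>n\<in>{1..x}. if e T dvd n then f n else 0))"
    by (subst sum.swap) (simp add: sum_distrib_left)
  also have "norm \<dots> \<le> (\<Sum>T\<in>Pow S. B)"
  proof (rule sum_norm_le)
    fix T assume "T \<in> Pow S"
    then have T: "p \<in> S" if "p \<in> T" for p using that by auto
    have "e T > 0" unfolding e_def using T by (intro prod_pos) (auto dest: prime_S prime_gt_0_nat)
    \<comment> \<open>Complete multiplicativity pulls \<open>f (e T)\<close> out and leaves a
      shorter partial sum of \<open>f\<close>. As \<open>f\<close> is unimodular on
      \<open>S\<close>, each of the \<open>2 ^ card S\<close> subsets contributes at most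
      \<open>B\<close>.\<close>
    then have "(\<Sum>n\<in>{1..x}. if e T dvd n then f n else 0) = f (e T) * (\<Sum>m\<in>{1..x div e T}. f m)"
      unfolding sum_distrib_left by (subst sum_multiples) (auto simp: f_mult)
    moreover have "norm (f (e T)) = 1"
      unfolding e_def completely_multiplicative_prod[OF cm_f] completely_multiplicative_power[OF cm_f]
      using T by (simp add: norm_f norm_power prod_norm [symmetric])
    moreover have "norm (\<Sum>m\<in>{1..x div e T}. f m) \<le> B" by (intro B) simp
    ultimately show "norm ((-1) ^ card T * (\<Sum>n\<in>{1..x}. if e T dvd n then f n else 0)) \<le> B"
      by (simp add: norm_mult norm_power)
  qed
  also have "\<dots> = 2 ^ card S * B" by (simp add: card_Pow)
  finally show ?thesis .
qed

lemma trunc_sum_mult_period: "trunc_sum N (period N * m) = of_nat m * trunc_sum N (period N)"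
  unfolding trunc_sum_def by (rule sum_periodic) (rule trunc_periodic)

lemma norm_trunc_fourier_ge:
  assumes \<delta>: "\<delta> > 0" "\<And>p. p \<in> S \<Longrightarrow> \<delta> \<le> norm (f p - chi p)"
    and L: "L > 0" "4 * (1/2) ^ L \<le> \<delta>"
    and I: "\<And>p. p \<in> S \<Longrightarrow> 1 \<le> I p" "\<And>p. p \<in> S \<Longrightarrow> I p + L \<le> N"
  shows "real (smooth (\<lambda>_. N)) * norm (gauss_sum q chi 1) * (\<delta> / 3) ^ card S / real (smooth I)
    \<le> norm (\<Sum>n\<in>{1..period N}. trunc N n * unity_root (q * smooth I) ^ n)"
proof -
  define t where "t = (\<lambda>p. \<Sum>j\<in>{0..N}. euler_coeff (f p) (chi p) N j *
    (if I p \<le> j then cnj (chi p) ^ (j - I p) / of_nat p ^ j else 0))"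
  have t: "\<delta> / 3 / real p ^ I p \<le> norm (t p)" if "p \<in> S" for p
    unfolding t_def using that
    by (intro norm_euler_factor_ge[where L = L])
      (use I(1) in \<open>auto simp: norm_f \<delta> L I(2) prime_ge_2_nat prime_S norm_character_le[OF char]\<close>)
  have IN: "I p \<le> N" if "p \<in> S" for p using I(2)[OF that] by simp
  have "(\<delta> / 3) ^ card S / real (smooth I) = (\<Prod>p\<in>S. \<delta> / 3 / real p ^ I p)"
    unfolding smooth_def of_nat_prod of_nat_power prod_dividef prod_constant power_divide ..
  also have "\<dots> \<le> (\<Prod>p\<in>S. norm (t p))"
    using t \<delta>(1) by (intro prod_mono) auto
  finally have "real (smooth (\<lambda>_. N)) * norm (gauss_sum q chi 1) * ((\<delta> / 3) ^ card S / real (smooth I))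
      \<le> real (smooth (\<lambda>_. N)) * norm (gauss_sum q chi 1) * (\<Prod>p\<in>S. norm (t p))"
    by (intro mult_left_mono) auto
  also have "\<dots> = norm (of_nat (smooth (\<lambda>_. N)) * gauss_sum q chi 1 * (\<Prod>p\<in>S. t p))"
    by (simp add: norm_mult prod_norm [symmetric])
  also have "\<dots> = norm (\<Sum>n\<in>{1..period N}. trunc N n * unity_root (q * smooth I) ^ n)"
    unfolding t_def by (subst trunc_fourier) (use IN in auto)
  finally show ?thesis by simp
qed

section \<open>Lower bound for the truncated sums\<close>

lemma smooth_inj:
  assumes "I \<in> PiE S A" "J \<in> PiE S A" "smooth I = smooth J"
  shows "I = J"
proof (rule PiE_ext[OF assms(1,2)])
  fix p assume "p \<in> S"
  then show "I p = J p"
    using assms(3) multiplicity_smooth[of p I] multiplicity_smooth[of p J] prime_S by simp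
qed

text \<open>The \<open>K ^ card S\<close> exponent vectors with entries in \<open>{1..K}\<close>
  give distinct frequencies, at each of which the Fourier coefficient of \<open>trunc_sum\<close> is
  at least \<open>P * c0\<close>. The margin \<open>L\<close> depends only on the distances between
  \<open>f\<close> and \<open>chi\<close> on \<open>S\<close>, not on \<open>K\<close>.\<close>

lemma trunc_sum_large:
  "\<exists>c>0. \<exists>L>0. \<forall>K B. trunc_sum (K + L) (period (K + L)) = 0 \<longrightarrow>
     (\<forall>x<period (K + L). norm (trunc_sum (K + L) x) \<le> B) \<longrightarrow> real K ^ card S * c \<le> B\<^sup>2"
proof -
  \<comment> \<open>The inserted 1 keeps the minimum defined when \<open>S\<close> is empty.\<close>
  define \<delta> where "\<delta> = Min (insert 1 ((\<lambda>p. norm (f p - chi p)) ` S))"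
  have "\<delta> > 0" unfolding \<delta>_def using f_neq_chi by auto
  have \<delta>: "\<delta> \<le> norm (f p - chi p)" if "p \<in> S" for p
    unfolding \<delta>_def using that by (intro Min_le) auto
  obtain L0 where L0: "(1/2) ^ L0 < \<delta> / 4"
    using real_arch_pow_inv[of "\<delta> / 4" "1/2"] \<open>\<delta> > 0\<close> by auto
  define L where "L = Suc L0"
  have L: "4 * (1/2) ^ L \<le> \<delta>" "L > 0"
    using L0 zero_le_power[of "1/2::real" L0] by (simp_all add: L_def, linarith)
  define c0 where "c0 = norm (gauss_sum q chi 1) * (\<delta> / 3) ^ card S / (2 * pi)"
  have "c0 > 0"
    using gauss_sum_1_nonzero[OF char primitive] \<open>\<delta> > 0\<close> by (simp add: c0_def)
  have "real K ^ card S * c0\<^sup>2 \<le> B\<^sup>2"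
    if zero: "trunc_sum (K + L) (period (K + L)) = 0"
      and B: "\<forall>x<period (K + L). norm (trunc_sum (K + L) x) \<le> B" for K B
  proof -
    define N where "N = K + L"
    define P where "P = period N"
    define H where "H = trunc_sum N"
    define D where "D = PiE S (\<lambda>_. {1..K})"
    define X where "X = (\<lambda>I. norm (\<Sum>n<P. H n * unity_root (q * smooth I) ^ n))"
    have "P > 0" by (simp only: P_def period_pos)
    have X: "real P * c0 \<le> X I" if "I \<in> D" for I
    proof -
      define z where "z = unity_root (q * smooth I)"
      have pos: "q > 0" "smooth I > 0" using q_pos smooth_pos by auto
      have "real (smooth (\<lambda>_. N)) * norm (gauss_sum q chi 1) * (\<delta> / 3) ^ card S / real (smooth I)
          \<le> norm (\<Sum>n\<in>{1..P}. trunc N n * z ^ n)"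
        unfolding z_def P_def using that
        by (intro norm_trunc_fourier_ge[where L = L]) (auto simp: \<open>\<delta> > 0\<close> \<delta> L D_def N_def PiE_iff)
      also have "(\<Sum>n\<in>{1..P}. trunc N n * z ^ n) = (1 - z) * (\<Sum>n<P. H n * z ^ n)"
        using zero by (intro sum_by_parts_root) (simp_all add: H_def trunc_sum_def N_def P_def)
      also have "norm \<dots> \<le> 2 * pi / (q * smooth I) * X I"
        unfolding norm_mult X_def z_def
        using norm_1_minus_unity_root[of "q * smooth I"] by (intro mult_right_mono) auto
      \<comment> \<open>The bounds \<open>1 / smooth I\<close> for the coefficient and
        \<open>2 * pi / (q * smooth I)\<close> for \<open>1 - z\<close> have the same decay, so the
        estimate for \<open>X I\<close> is uniform in \<open>I\<close>.\<close>
      finally show ?thesis using pos by (simp add: c0_def P_def field_simps)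
    qed
    have orth: "(\<Sum>n<P. unity_root (q * smooth I) ^ n * cnj (unity_root (q * smooth J) ^ n)) =
        (if I = J then of_real (real P) else 0)" if "I \<in> D" "J \<in> D" for I J
    proof -
      have "q * smooth I dvd P" if "I \<in> D" for I
        using that by (auto simp: P_def smooth_dvd_smooth_iff D_def PiE_iff N_def trans_le_add1)
      moreover have "q * smooth I = q * smooth J \<longleftrightarrow> I = J"
        using that smooth_inj q_pos by (auto simp: D_def)
      ultimately show ?thesis
        using unity_root_orthogonal[OF \<open>P > 0\<close>, of "q * smooth I" "q * smooth J"] that by simp
    qed
    have "finite D" unfolding D_def by (intro finite_PiE) auto
    have "real K ^ card S * (real P * c0)\<^sup>2 = (\<Sum>I\<in>D. (real P * c0)\<^sup>2)"
      by (simp add: D_def card_PiE)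
    also have "\<dots> \<le> (\<Sum>I\<in>D. (X I)\<^sup>2)"
      using X \<open>c0 > 0\<close> by (intro sum_mono power_mono) auto
    also have "\<dots> \<le> real P * (\<Sum>n<P. (norm (H n))\<^sup>2)"
      unfolding X_def by (rule sum_bessel[OF \<open>finite D\<close> _ orth]) (use \<open>P > 0\<close> in auto)
    also have "\<dots> \<le> real P * (\<Sum>n<P. B\<^sup>2)"
      using B by (intro mult_left_mono sum_mono power_mono) (auto simp: H_def P_def N_def)
    also have "\<dots> = (real P)\<^sup>2 * B\<^sup>2" by (simp add: power2_eq_square)
    finally show ?thesis using \<open>P > 0\<close> by (simp add: power_mult_distrib mult_ac)
  qed
  with \<open>c0 > 0\<close> \<open>L > 0\<close> show ?thesis
    by (intro exI[of _ "c0\<^sup>2"] conjI exI[of _ L]) auto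
qed

text \<open>Under the bound, \<open>trunc_sum_large\<close> would give \<open>K ^ card S\<close> at
  most a constant times \<open>(1 + ln P) ^ (card S - 1)\<close>, where \<open>ln P\<close> grows
  only linearly in \<open>K\<close>. The summand 1 keeps the bound positive at
  \<open>n = 1\<close>.\<close>

lemma partial_sums_unbounded:
  assumes "S \<noteq> {}"
  shows "\<not> (\<forall>n\<ge>1. (norm (\<Sum>m\<in>{1..n}. f m))\<^sup>2 \<le> C * (1 + ln (real n)) ^ (card S - 1))"
proof
  assume "\<forall>n\<ge>1. (norm (\<Sum>m\<in>{1..n}. f m))\<^sup>2 \<le> C * (1 + ln (real n)) ^ (card S - 1)"
  then have bound: "(norm (\<Sum>m\<in>{1..n}. f m))\<^sup>2 \<le> C * (1 + ln (real n)) ^ (card S - 1)" if "n \<ge> 1" for n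
    using that by blast
  define k where "k = card S - 1"
  have k: "card S = Suc k" using assms by (simp add: k_def card_gt_0_iff)
  define C' where "C' = 4 ^ card S * C"
  \<comment> \<open>At \<open>n = 1\<close> the partial sum is \<open>f 1 = 1\<close> and the
    logarithm vanishes.\<close>
  have "C \<ge> 1" using bound[of 1] completely_multiplicativeD[OF cm_f] by simp
  then have "C' > 0" by (simp add: C'_def)
  define b where "b = (\<lambda>x. 2 ^ card S * sqrt (C * (1 + ln (real x)) ^ k))"
  have b2: "(b x)\<^sup>2 = C' * (1 + ln (real x)) ^ k" if "x \<ge> 1" for x
  proof -
    have "(2 ^ card S)\<^sup>2 = (4 :: real) ^ card S"
      by (simp flip: power_mult_distrib add: power2_eq_square)
    with that \<open>C \<ge> 1\<close> show ?thesis by (simp add: b_def C'_def power_mult_distrib)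
  qed
  have trunc_le: "norm (trunc_sum N y) \<le> b x" if "N > 0" "y \<le> x" "x \<ge> 1" for N x y
    unfolding b_def
  proof (rule norm_trunc_sum_le[OF \<open>N > 0\<close>])
    fix w assume "w \<le> y"
    show "norm (\<Sum>n\<in>{1..w}. f n) \<le> sqrt (C * (1 + ln (real x)) ^ k)"
    proof (cases "w = 0")
      case True
      then show ?thesis using \<open>C \<ge> 1\<close> \<open>x \<ge> 1\<close> by simp
    next
      case False
      then have "(norm (\<Sum>n\<in>{1..w}. f n))\<^sup>2 \<le> C * (1 + ln (real w)) ^ k"
        using bound[of w] by (simp add: k_def)
      also have "\<dots> \<le> C * (1 + ln (real x)) ^ k"
        using \<open>C \<ge> 1\<close> False \<open>w \<le> y\<close> that by (intro mult_left_mono power_mono) auto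
      finally show ?thesis by (rule real_le_rsqrt)
    qed
  qed
  text \<open>A nonzero sum over one period would make the partial sums grow linearly.\<close>
  have zero: "trunc_sum N (period N) = 0" if "N > 0" for N
  proof -
    define h where "h = norm (trunc_sum N (period N))"
    define P where "P = period N"
    have "P > 0" by (simp only: P_def period_pos)
    \<comment> \<open>With this \<open>u\<close>, \<open>exp (u m)\<close> is
      \<open>exp 1 * P * m\<close>, so linear growth against a power of a logarithm becomes the
      standard limit of \<open>u ^ k / exp u\<close>.\<close>
    define u where "u = (\<lambda>m. 1 + ln (real (P * m)))"
    have "filterlim (\<lambda>m. real (P * m)) at_top sequentially"
      unfolding of_nat_mult using \<open>P > 0\<close>
      by (intro filterlim_tendsto_pos_mult_at_top[OF tendsto_const] filterlim_real_sequentially) auto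
    then have "filterlim u at_top sequentially"
      unfolding u_def
      by (intro filterlim_tendsto_add_at_top[OF tendsto_const] filterlim_compose[OF ln_at_top])
    then have lim: "(\<lambda>m. C' * (exp 1 * real P) * (u m ^ k / exp (u m))) \<longlonglongrightarrow> C' * (exp 1 * real P) * 0"
      by (intro tendsto_mult tendsto_const filterlim_compose[OF tendsto_power_div_exp_0])
    have "h\<^sup>2 \<le> C' * (exp 1 * real P) * (u m ^ k / exp (u m))" if "m \<ge> 1" for m
    proof -
      have Pm: "P * m \<ge> 1" using \<open>P > 0\<close> that by (simp add: Suc_le_eq)
      \<comment> \<open>One factor \<open>m\<close> is given up; linear growth of the square already
        suffices.\<close>
      have "h\<^sup>2 * real m \<le> (real m * h)\<^sup>2"
        using that mult_left_mono[of 1 "real m" "h\<^sup>2 * real m"]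
        by (simp add: h_def power2_eq_square mult_ac)
      also have "\<dots> \<le> (b (P * m))\<^sup>2"
      proof (rule power_mono)
        show "real m * h \<le> b (P * m)"
          using trunc_le[OF \<open>N > 0\<close> order_refl Pm]
          unfolding P_def trunc_sum_mult_period h_def by (simp add: norm_mult)
      qed (simp add: h_def)
      also have "\<dots> = C' * u m ^ k" unfolding u_def by (rule b2[OF Pm])
      finally have "h\<^sup>2 * real m \<le> C' * u m ^ k" .
      moreover have "exp (u m) = exp 1 * real P * real m"
        using Pm by (simp add: u_def exp_add)
      ultimately show ?thesis using \<open>P > 0\<close> that by (simp add: field_simps)
    qed
    then have "h\<^sup>2 \<le> C' * (exp 1 * real P) * 0"
      by (intro tendsto_lowerbound[OF lim]) (auto simp: eventually_at_top_linorder)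
    then show ?thesis by (simp add: h_def)
  qed
  obtain c L where "c > 0" "L > 0" and large: "\<And>K B. trunc_sum (K + L) (period (K + L)) = 0 \<Longrightarrow>
      (\<And>x. x < period (K + L) \<Longrightarrow> norm (trunc_sum (K + L) x) \<le> B) \<Longrightarrow> real K ^ card S * c \<le> B\<^sup>2"
    using trunc_sum_large by blast
  define W where "W = (\<Sum>p\<in>S. ln (real p))"
  have "W \<ge> 0" unfolding W_def by (intro sum_nonneg) (auto dest!: prime_S prime_ge_2_nat)
  \<comment> \<open>Chosen so that \<open>1 + ln P \<le> K * E\<close> for all
    \<open>K \<ge> 1\<close>, where \<open>ln P = ln q + (K + L) * W\<close>.\<close>
  define E where "E = 1 + ln (real q) + (1 + real L) * W"
  have "real K * c \<le> C' * E ^ k" if "K \<ge> 1" for K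
  proof -
    define P where "P = period (K + L)"
    have "P \<ge> 1" using period_pos[of "K + L"] by (simp add: P_def)
    have "ln (real (smooth (\<lambda>_. K + L))) = (\<Sum>p\<in>S. ln (real p ^ (K + L)))"
      unfolding smooth_def of_nat_prod of_nat_power
      by (rule ln_prod) (auto dest!: prime_S prime_gt_0_nat)
    also have "\<dots> = (\<Sum>p\<in>S. real (K + L) * ln (real p))"
      by (intro sum.cong refl ln_realpow)
    also have "\<dots> = real (K + L) * W" by (simp only: W_def sum_distrib_left)
    finally have "ln (real P) = ln (real q) + real (K + L) * W"
      unfolding P_def using q_pos smooth_pos by (simp add: ln_mult)
    moreover have "1 \<le> real K * 1" "ln (real q) \<le> real K * ln (real q)" "real L * W \<le> real K * (real L * W)"
      using that q_pos \<open>W \<ge> 0\<close> mult_right_mono[of 1 "real K"] by auto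
    ultimately have "1 + ln (real P) \<le> real K * E"
      by (simp add: E_def algebra_simps)
    then have le: "(1 + ln (real P)) ^ k \<le> (real K * E) ^ k"
      using \<open>P \<ge> 1\<close> by (intro power_mono) auto
    have "real K ^ card S * c \<le> (b P)\<^sup>2"
    proof (rule large)
      show "trunc_sum (K + L) (period (K + L)) = 0" by (rule zero) (use \<open>L > 0\<close> in simp)
    next
      fix x assume "x < period (K + L)"
      then show "norm (trunc_sum (K + L) x) \<le> b P"
        using \<open>L > 0\<close> \<open>P \<ge> 1\<close> by (intro trunc_le) (auto simp: P_def)
    qed
    also have "\<dots> = C' * (1 + ln (real P)) ^ k" by (rule b2) fact
    also have "\<dots> \<le> C' * (real K * E) ^ k" using le \<open>C' > 0\<close> by simp
    \<comment> \<open>Cancelling \<open>K ^ k\<close> leaves a single power of \<open>K\<close> on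
      the left, hence a bound for all \<open>K\<close>.\<close>
    finally have "real K ^ k * (real K * c) \<le> real K ^ k * (C' * E ^ k)"
      by (simp add: k power_mult_distrib mult_ac)
    then show ?thesis using that by simp
  qed
  then have le: "real K \<le> C' * E ^ k / c" if "K \<ge> 1" for K
    using that \<open>c > 0\<close> by (simp add: field_simps)
  obtain K where K: "real K > max 1 (C' * E ^ k / c)" using reals_Archimedean2 by blast
  then have "K \<ge> 1" by simp
  from le[OF this] K show False by simp
qed

end

section \<open>Deduction of the Omega bound\<close>

theorem theorem1p1:
  fixes chi f :: "nat \<Rightarrow> complex" and q :: nat and S :: "nat set"
  assumes "primitive_character q chi"
    and "finite S" and "\<forall>p\<in>S. prime p"
    and "completely_multiplicative f"
    and "\<forall>p. prime p \<longrightarrow> p \<notin> S \<longrightarrow> f p = chi p"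
    and "\<forall>p\<in>S. f p \<noteq> chi p \<and> norm (f p) = 1"
  shows "\<exists>c>0. \<exists>\<^sub>F x in at_top.
           norm (\<Sum>n\<in>{1..nat \<lfloor>x\<rfloor>}. f n) / ln x powr ((real (card S) - 3) / 2) \<ge> (c::real)"
proof (rule ccontr)
  assume contra: "\<not> ?thesis"
  interpret unimodular_modification chi f q S
    by standard (use assms in auto)
  define A where "A = (real (card S) - 3) / 2"
  define M where "M = (\<lambda>n. \<Sum>m\<in>{1..n}. f m)"
  \<comment> \<open>The negation excludes every positive constant; \<open>c = 1\<close> is
    enough.\<close>
  from contra have "\<forall>\<^sub>F x in at_top. \<not> 1 \<le> norm (M (nat \<lfloor>x\<rfloor>)) / ln x powr A"
    unfolding M_def A_def not_frequently [symmetric] using zero_less_one by blast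
  then obtain x0 where x0: "norm (M (nat \<lfloor>x\<rfloor>)) / ln x powr A < 1" if "x \<ge> x0" for x
    by (auto simp: eventually_at_top_linorder not_le)
  \<comment> \<open>The 3 exceeds \<open>exp 1\<close>, so logarithms are at least 1 from
    \<open>n0\<close> on and larger exponents give larger powers.\<close>
  define n0 where "n0 = max 3 (nat \<lceil>x0\<rceil>)"
  have ln_ge_1: "ln (real n) \<ge> 1" if "n \<ge> n0" for n
  proof -
    have "exp 1 \<le> real n" using that exp_le by (simp add: n0_def)
    then show ?thesis using that by (subst ln_ge_iff) (auto simp: n0_def)
  qed
  have small: "norm (M n) \<le> ln (real n) powr A" if "n \<ge> n0" for n
  proof -
    have "real n \<ge> x0" using that unfolding n0_def by linarith
    moreover have "ln (real n) powr A > 0" using ln_ge_1[OF that] by simp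
    ultimately show ?thesis using x0[of "real n"] by (simp add: field_simps)
  qed
  show False
  proof (cases "S = {}")
    \<comment> \<open>Here \<open>f\<close> agrees with \<open>chi\<close> at positive integers and
      the exponent is -3/2, so the assumed bound would force the partial sums to tend to zero. They
      cannot: just after a multiple of \<open>q\<close> they jump by
      \<open>chi 1 = 1\<close>.\<close>
    case True
    have "(\<lambda>n. ln (real n) powr (-3/2)) \<longlonglongrightarrow> 0"
      by (intro tendsto_neg_powr filterlim_compose[OF ln_at_top] filterlim_real_sequentially) auto
    then have "\<forall>\<^sub>F n in sequentially. ln (real n) powr A < 1/2"
      using True by (intro order_tendstoD) (auto simp: A_def)
    then obtain n1 where n1: "ln (real n) powr A < 1/2" if "n \<ge> n1" for n
      by (auto simp: eventually_at_top_linorder)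
    define n where "n = q * (n0 + n1)"
    have n: "n \<ge> n0 + n1" using q_pos by (simp add: n_def)
    have "f (Suc n) = chi (Suc n)" by (rule f_eq_chi_coprime) (use True in auto)
    also have "\<dots> = chi 1" by (rule character_cong[OF char]) (simp add: n_def mod_Suc)
    also have "\<dots> = 1" by (rule completely_multiplicativeD[OF cm_chi])
    finally have "M (Suc n) - M n = 1" by (simp add: M_def)
    then have "1 \<le> norm (M (Suc n)) + norm (M n)"
      using norm_triangle_ineq4[of "M (Suc n)" "M n"] by simp
    moreover have "norm (M (Suc n)) < 1/2" "norm (M n) < 1/2"
      using small[of n] small[of "Suc n"] n1[of n] n1[of "Suc n"] n by auto
    ultimately show False by simp
  next
    case False
    define k where "k = card S - 1"
    have k: "card S = Suc k" using False by (simp add: k_def card_gt_0_iff)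
    define C0 where "C0 = (\<Sum>m\<in>{1..n0}. norm (f m))"
    have "(norm (M n))\<^sup>2 \<le> max 1 (C0\<^sup>2) * (1 + ln (real n)) ^ k" if "n \<ge> 1" for n
    proof (cases "n \<ge> n0")
      case True
      have "norm (M n) \<le> ln (real n) powr A" by (rule small) fact
      \<comment> \<open>With \<open>k = card S - 1\<close> one has \<open>A = k / 2 - 1\<close>, so
        the assumed bound implies the weaker one refuted by
        \<open>partial_sums_unbounded\<close>.\<close>
      also have "\<dots> \<le> ln (real n) powr (real k / 2)"
        using ln_ge_1[OF True] by (intro powr_mono) (auto simp: A_def k)
      finally have "(norm (M n))\<^sup>2 \<le> (ln (real n) powr (real k / 2))\<^sup>2" by (rule power_mono) simp
      also have "\<dots> = ln (real n) ^ k"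
        using ln_ge_1[OF True] by (simp add: power2_eq_square powr_realpow flip: powr_add)
      also have "\<dots> \<le> (1 + ln (real n)) ^ k"
        using ln_ge_1[OF True] by (intro power_mono) auto
      also have "\<dots> \<le> max 1 (C0\<^sup>2) * (1 + ln (real n)) ^ k"
        using mult_right_mono[of 1 "max 1 (C0\<^sup>2)" "(1 + ln (real n)) ^ k"] ln_ge_1[OF True] by simp
      finally show ?thesis .
    next
      \<comment> \<open>The finitely many \<open>n\<close> below \<open>n0\<close> are absorbed into
        the constant through \<open>C0\<close>.\<close>
      case n: False
      have "norm (M n) \<le> (\<Sum>m\<in>{1..n}. norm (f m))" unfolding M_def by (rule norm_sum)
      also have "\<dots> \<le> C0" unfolding C0_def using n by (intro sum_mono2) auto
      finally have "(norm (M n))\<^sup>2 \<le> C0\<^sup>2" by (rule power_mono) simp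
      also have "\<dots> \<le> max 1 (C0\<^sup>2) * 1" by simp
      also have "\<dots> \<le> max 1 (C0\<^sup>2) * (1 + ln (real n)) ^ k"
        using that by (intro mult_left_mono one_le_power) auto
      finally show ?thesis .
    qed
    with partial_sums_unbounded[OF False, of "max 1 (C0\<^sup>2)"] show False
      unfolding M_def k_def by blast
  qed
qed

end
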